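(* Let $\boldsymbol{X}=(X_1,\dots,X_d)$ follow the multivariate thinning-dependence Poisson distribution with background Poisson random variables $Y_1,\dots,Y_l$ of rates $\theta_1,\dots,\theta_l$ and thinning probabilities $p_j^k$, $j=1,\dots,d$, $k=1,\dots,l$, and let $i\in\{1,\dots,d\}$. Then for every $x\in\mathbb N=\{0,1,2,\dots\}$, as $p_i^k\to1$ for all $k=1,\dots,l$ (all other parameters fixed), $$F_{M^{\boldsymbol X}}(x)\sim F_{X_i}(x),\qquad F_{m^{\boldsymbol X}}(x)\sim F_{m_{-i}^{\boldsymbol X}}(x).$$
   Context: Multivariate thinning-dependence Poisson distribution: let $Y_1,\dots,Y_l$ be independent Poisson random variables with rates $\theta_1,\dots,\theta_l>0$, let $p_j^k\in[0,1]$ for $j=1,\dots,d$, $k=1,\dots,l$, and let $\boldsymbol X=(X_1,\dots,X_d)$ with $X_j=\sum_{k=1}^{l}X_j^k$. The vector $\boldsymbol X$ follows the multivariate thinning-dependence Poisson distribution if: (i) conditionally on $Y_k=y_k$, $X_j^k$ is binomial with parameters $y_k$ and $p_j^k$, i.e. $\mathbb P(X_j^k=z\mid Y_k=y_k)=\binom{y_k}{z}(p_j^k)^z(1-p_j^k)^{y_k-z}$ for $0\le z\le y_k$; (ii) for each $k$, $X_1^k,\dots,X_d^k$ are conditionally independent given $Y_k=y_k$; (iii) the $l$ random vectors $(Y_1,X_1^1,\dots,X_d^1),\dots,(Y_l,X_1^l,\dots,X_d^l)$ are independent. $M^{\boldsymbol X}=\max(X_1,\dots,X_d)$, $m^{\boldsymbol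 X}=\min(X_1,\dots,X_d)$, and $m_{-i}^{\boldsymbol X}$ is the minimum of the components $X_j$ with $j\ne i$. $F_W$ denotes the cumulative distribution function of a random variable $W$. The notation $f\sim g$ in a limit of the parameters means that the ratio $f/g$ tends to $1$ in that limit. *)

theory Defs
  imports "HOL-Probability.Probability"
begin

text \<open>
  The types \<open>'l\<close> and \<open>'d\<close> index the background variables and the components of the vector.
  \<open>Y k\<close> is the \<open>k\<close>-th background variable and \<open>Z j k\<close> stands for \<open>X\<^sub>j\<^sup>k\<close>.
  Every event \<open>Y k = y\<close> has positive probability, so conditioning on it is elementary and the
  conditional probability measure given \<open>Y k = y\<close> is
  \<open>uniform_measure M {\<omega> \<in> space M. Y k \<omega> = y}\<close>.
\<close>

definition thinning_representation ::
  "'a measure \<Rightarrow> ('l::finite \<Rightarrow> real) \<Rightarrow> ('d::finite \<Rightarrow> 'l \<Rightarrow> real) \<Rightarrow>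
   ('l \<Rightarrow> 'a \<Rightarrow> nat) \<Rightarrow> ('d \<Rightarrow> 'l \<Rightarrow> 'a \<Rightarrow> nat) \<Rightarrow> bool" where
  "thinning_representation M \<theta> p Y Z \<longleftrightarrow>
     prob_space M \<and>
     (\<forall>k. 0 < \<theta> k) \<and>
     (\<forall>j k. 0 \<le> p j k \<and> p j k \<le> 1) \<and>
     prob_space.indep_vars M (\<lambda>_. count_space UNIV) Y UNIV \<and>
     (\<forall>k. distr M (count_space UNIV) (Y k) = measure_pmf (poisson_pmf (\<theta> k))) \<and>
     (\<forall>j k y. \<forall>z\<le>y.
        cond_prob M (\<lambda>\<omega>. Z j k \<omega> = z) (\<lambda>\<omega>. Y k \<omega> = y) =
          real (y choose z) * p j k ^ z * (1 - p j k) ^ (y - z)) \<and>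
     (\<forall>k y. prob_space.indep_vars (uniform_measure M {\<omega> \<in> space M. Y k \<omega> = y})
        (\<lambda>_. count_space UNIV) (\<lambda>j. Z j k) UNIV) \<and>
     prob_space.indep_vars M
       (\<lambda>_. count_space UNIV \<Otimes>\<^sub>M (\<Pi>\<^sub>M j\<in>UNIV. count_space UNIV))
       (\<lambda>k \<omega>. (Y k \<omega>, \<lambda>j. Z j k \<omega>)) UNIV"

definition thinning_dependence_poisson ::
  "'a measure \<Rightarrow> ('l::finite \<Rightarrow> real) \<Rightarrow> ('d::finite \<Rightarrow> 'l \<Rightarrow> real) \<Rightarrow>
   ('d \<Rightarrow> 'a \<Rightarrow> nat) \<Rightarrow> bool" where
  "thinning_dependence_poisson M \<theta> p X \<longleftrightarrow>
     (\<exists>Y Z. thinning_representation M \<theta> p Y Z \<and>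
            (\<forall>j. \<forall>\<omega>\<in>space M. X j \<omega> = (\<Sum>k\<in>UNIV. Z j k \<omega>)))"

definition rv_cdf :: "'a measure \<Rightarrow> ('a \<Rightarrow> nat) \<Rightarrow> real \<Rightarrow> real" where
  "rv_cdf M W = cdf (distr M borel (\<lambda>\<omega>. real (W \<omega>)))"

definition max_comp :: "('d::finite \<Rightarrow> 'a \<Rightarrow> nat) \<Rightarrow> 'a \<Rightarrow> nat" where
  "max_comp X \<omega> = Max (range (\<lambda>j. X j \<omega>))"

definition min_comp :: "('d::finite \<Rightarrow> 'a \<Rightarrow> nat) \<Rightarrow> 'a \<Rightarrow> nat" where
  "min_comp X \<omega> = Min (range (\<lambda>j. X j \<omega>))"

text \<open>Meaningful only if there is an index other than \<open>i\<close>.\<close>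

definition min_comp_except :: "'d \<Rightarrow> ('d::finite \<Rightarrow> 'a \<Rightarrow> nat) \<Rightarrow> 'a \<Rightarrow> nat" where
  "min_comp_except i X \<omega> = Min ((\<lambda>j. X j \<omega>) ` (UNIV - {i}))"

end

theory Submission imports Defs begin

text \<open>
  Thinning only removes points, so almost surely \<open>X j \<le> (\<Sum>k\<in>UNIV. Y k)\<close> for all \<open>j\<close>, with equality
  for \<open>j = i\<close> on the event that \<open>Z i k = Y k\<close> for all \<open>k\<close>. On that event \<open>X i\<close> is the largest
  component, so the maximum is \<open>X i\<close> and the minimum is attained off \<open>i\<close>. Since
  \<open>P (Z i k = Y k) = exp (- \<theta> k * (1 - p i k))\<close>, the complementary event has probability tending
  to \<open>0\<close>. The denominators stay away from \<open>0\<close>, because each is at least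
  \<open>P (Y = 0) = exp (- (\<Sum>k\<in>UNIV. \<theta> k))\<close>.
\<close>

section \<open>Measurability and pointwise values of the maximum and minima\<close>

text \<open>A finite index type and countable values make the function type countable, so preimages
  of single functions suffice. Every function of the whole vector, in particular each maximum or
  minimum below, is then measurable by composition.\<close>

lemma measurable_fun_count_space:
  fixes X :: "'d::finite \<Rightarrow> 'a \<Rightarrow> 'b::countable"
  assumes [measurable]: "\<And>j. X j \<in> measurable M (count_space UNIV)"
  shows "(\<lambda>\<omega> j. X j \<omega>) \<in> measurable M (count_space UNIV)"
proof (subst measurable_count_space_eq2_countable, safe)
  fix f :: "'d \<Rightarrow> 'b"
  have "(\<lambda>\<omega> j. X j \<omega>) -` {f} \<inter> space M = {\<omega>\<in>space M. \<forall>j. X j \<omega> = f j}"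
    by (auto simp: fun_eq_iff)
  also have "\<dots> \<in> sets M"
    by measurable
  finally show "(\<lambda>\<omega> j. X j \<omega>) -` {f} \<inter> space M \<in> sets M" .
qed auto

lemma measurable_max_comp:
  assumes "\<And>j. X j \<in> measurable M (count_space UNIV)"
  shows "max_comp X \<in> measurable M (count_space UNIV)"
  using measurable_compose[OF measurable_fun_count_space[OF assms],
      of "\<lambda>f. Max (range f)" "count_space UNIV"]
  by (simp add: max_comp_def[abs_def])

lemma measurable_min_comp:
  assumes "\<And>j. X j \<in> measurable M (count_space UNIV)"
  shows "min_comp X \<in> measurable M (count_space UNIV)"
  using measurable_compose[OF measurable_fun_count_space[OF assms],
      of "\<lambda>f. Min (range f)" "count_space UNIV"]
  by (simp add: min_comp_def[abs_def])

lemma measurable_min_comp_except: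
  assumes "\<And>j. X j \<in> measurable M (count_space UNIV)"
  shows "min_comp_except i X \<in> measurable M (count_space UNIV)"
  using measurable_compose[OF measurable_fun_count_space[OF assms],
      of "\<lambda>f. Min (f ` (UNIV - {i}))" "count_space UNIV"]
  by (simp add: min_comp_except_def[abs_def])

lemma max_comp_eq:
  assumes "\<And>j. X j \<omega> \<le> X i \<omega>"
  shows "max_comp X \<omega> = X i \<omega>"
  unfolding max_comp_def using assms by (intro Max_eqI) auto

text \<open>Removing a largest component leaves the minimum unchanged as long as another one
  remains. The index \<open>j\<close> serves to keep \<open>Min\<close> away from the empty
  set.\<close>

lemma min_comp_eq_min_comp_except:
  fixes X :: "'d::finite \<Rightarrow> 'a \<Rightarrow> nat"
  assumes "\<And>j. X j \<omega> \<le> X i \<omega>" "j \<noteq> i"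
  shows "min_comp X \<omega> = min_comp_except i X \<omega>"
proof -
  let ?B = "(\<lambda>j. X j \<omega>) ` (UNIV - {i})"
  have ne: "?B \<noteq> {}"
    using assms(2) by auto
  have "Min ?B \<in> ?B"
    using ne by (intro Min_in) auto
  then have "Min ?B \<le> X i \<omega>"
    using assms(1) by auto
  have "range (\<lambda>j. X j \<omega>) = insert (X i \<omega>) ?B"
    by auto
  then have "min_comp X \<omega> = min (X i \<omega>) (Min ?B)"
    using ne by (simp only: min_comp_def) (subst Min_insert; auto)
  then show ?thesis
    using \<open>Min ?B \<le> X i \<omega>\<close> by (simp add: min_comp_except_def)
qed

lemma min_comp_except_eq_0:
  fixes X :: "'d::finite \<Rightarrow> 'a \<Rightarrow> nat"
  assumes "\<And>j. X j \<omega> = 0" "j \<noteq> i"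
  shows "min_comp_except i X \<omega> = 0"
proof -
  have "(\<lambda>j. X j \<omega>) ` (UNIV - {i}) = {0}"
    using assms by auto
  then show ?thesis
    by (simp add: min_comp_except_def)
qed

lemma rv_cdf_eq:
  assumes [measurable]: "W \<in> measurable M (count_space UNIV)"
  shows "rv_cdf M W (real x) = measure M {\<omega> \<in> space M. W \<omega> \<le> x}"
proof -
  have "rv_cdf M W (real x) = measure M ((\<lambda>\<omega>. real (W \<omega>)) -` {..real x} \<inter> space M)"
    unfolding rv_cdf_def cdf_def by (intro measure_distr) measurable
  also have "(\<lambda>\<omega>. real (W \<omega>)) -` {..real x} \<inter> space M = {\<omega> \<in> space M. W \<omega> \<le> x}"
    by auto
  finally show ?thesis .
qed

section \<open>Probabilities in the thinning model\<close>

lemma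
  assumes rep: "thinning_representation M \<theta> p Y Z"
  shows thinning_prob_space: "prob_space M"
    and thinning_rate_pos: "0 < \<theta> k"
    and thinning_measurable_Y: "Y k \<in> measurable M (count_space UNIV)"
    and thinning_measurable_Z: "Z j k \<in> measurable M (count_space UNIV)"
    and thinning_prob_Y: "measure M {\<omega> \<in> space M. Y k \<omega> = y} = \<theta> k ^ y / fact y * exp (- \<theta> k)"
proof -
  show "prob_space M" and pos: "0 < \<theta> k"
    using rep by (auto simp: thinning_representation_def)
  interpret prob_space M by fact
  show Y[measurable]: "Y k \<in> measurable M (count_space UNIV)"
    using rep by (auto simp: thinning_representation_def indep_vars_def)
  have [measurable]: "(\<lambda>\<omega>. (Y k \<omega>, \<lambda>j. Z j k \<omega>)) \<in>
      measurable M (count_space UNIV \<Otimes>\<^sub>M (\<Pi>\<^sub>M j\<in>UNIV. count_space UNIV))"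
    using rep by (auto simp: thinning_representation_def indep_vars_def)
  \<comment> \<open>Measurability of \<open>Z j k\<close> is implicit in the independence of the
    vectors over \<open>k\<close>; it is recovered by projecting the vector to its
    \<open>j\<close>-th thinned entry.\<close>
  have "(\<lambda>\<omega>. snd (Y k \<omega>, \<lambda>j. Z j k \<omega>) j) \<in> measurable M (count_space UNIV)"
    by measurable
  then show "Z j k \<in> measurable M (count_space UNIV)"
    by simp
  have "measure M {\<omega> \<in> space M. Y k \<omega> = y} = measure (distr M (count_space UNIV) (Y k)) {y}"
    by (subst measure_distr) (auto intro!: arg_cong[where f = "measure M"])
  also have "\<dots> = pmf (poisson_pmf (\<theta> k)) y"
    using rep by (simp add: thinning_representation_def pmf.rep_eq)
  also have "\<dots> = \<theta> k ^ y / fact y * exp (- \<theta> k)"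
    using pos by (simp add: pmf_poisson)
  finally show "measure M {\<omega> \<in> space M. Y k \<omega> = y} = \<theta> k ^ y / fact y * exp (- \<theta> k)" .
qed

text \<open>The quotient defining \<open>cond_prob\<close> can be cleared because a Poisson variable
  of positive rate takes each value with positive probability.\<close>

lemma thinning_prob_joint:
  assumes rep: "thinning_representation M \<theta> p Y Z" and "z \<le> y"
  shows "measure M {\<omega> \<in> space M. Z j k \<omega> = z \<and> Y k \<omega> = y} =
    real (y choose z) * p j k ^ z * (1 - p j k) ^ (y - z) * measure M {\<omega> \<in> space M. Y k \<omega> = y}"
proof -
  have "measure M {\<omega> \<in> space M. Y k \<omega> = y} \<noteq> 0"
    using thinning_rate_pos[OF rep, of k] by (simp add: thinning_prob_Y[OF rep])
  moreover have "cond_prob M (\<lambda>\<omega>. Z j k \<omega> = z) (\<lambda>\<omega>. Y k \<omega> = y) =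
      real (y choose z) * p j k ^ z * (1 - p j k) ^ (y - z)"
    using rep \<open>z \<le> y\<close> by (simp add: thinning_representation_def)
  ultimately show ?thesis
    by (simp add: cond_prob_def field_simps)
qed

text \<open>The model prescribes conditional probabilities only for \<open>z \<le> y\<close>. By the
  binomial theorem these already sum to \<open>1\<close>, so no mass is left for larger values; the
  exceptional null sets are then united over the countably many \<open>y\<close>.\<close>

lemma thinning_AE_le:
  assumes rep: "thinning_representation M \<theta> p Y Z"
  shows "AE \<omega> in M. Z j k \<omega> \<le> Y k \<omega>"
proof -
  interpret prob_space M
    by (rule thinning_prob_space[OF rep])
  note [measurable] = thinning_measurable_Y[OF rep] thinning_measurable_Z[OF rep]
  have "AE \<omega> in M. Y k \<omega> = y \<longrightarrow> Z j k \<omega> \<le> y" for y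
  proof -
    let ?Y = "{\<omega> \<in> space M. Y k \<omega> = y}"
    let ?A = "\<lambda>z. {\<omega> \<in> space M. Z j k \<omega> = z \<and> Y k \<omega> = y}"
    have "measure M (\<Union>z\<in>{..y}. ?A z) = (\<Sum>z\<le>y. measure M (?A z))"
      by (intro finite_measure_finite_Union) (auto simp: disjoint_family_on_def)
    also have "\<dots> = (\<Sum>z\<le>y. real (y choose z) * p j k ^ z * (1 - p j k) ^ (y - z)) * measure M ?Y"
      by (simp add: thinning_prob_joint[OF rep] sum_distrib_right)
    also have "\<dots> = measure M ?Y"
      by (simp add: binomial_ring[symmetric])
    finally have "measure M (?Y - (\<Union>z\<in>{..y}. ?A z)) = 0"
      by (subst finite_measure_Diff) auto
    moreover have "?Y - (\<Union>z\<in>{..y}. ?A z) = {\<omega> \<in> space M. \<not> (Y k \<omega> = y \<longrightarrow> Z j k \<omega> \<le> y)}"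
      by auto
    ultimately show ?thesis
      by (intro AE_I[OF order_refl]) (auto simp: emeasure_eq_measure)
  qed
  then have "AE \<omega> in M. \<forall>y. Y k \<omega> = y \<longrightarrow> Z j k \<omega> \<le> y"
    by (intro AE_all_countable[THEN iffD2] allI)
  then show ?thesis
    by simp
qed

text \<open>For \<open>z = y\<close> the binomial weight reduces to \<open>p j k ^ y\<close>.
  Weighted by the Poisson probabilities and summed over \<open>y\<close>, it gives the exponential
  series at \<open>\<theta> k * p j k\<close>, scaled by \<open>exp (- \<theta> k)\<close>.\<close>

lemma thinning_prob_full:
  assumes rep: "thinning_representation M \<theta> p Y Z"
  shows "measure M {\<omega> \<in> space M. Z j k \<omega> = Y k \<omega>} = exp (- (\<theta> k * (1 - p j k)))"
proof -
  interpret prob_space M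
    by (rule thinning_prob_space[OF rep])
  note [measurable] = thinning_measurable_Y[OF rep] thinning_measurable_Z[OF rep]
  let ?A = "\<lambda>y. {\<omega> \<in> space M. Z j k \<omega> = y \<and> Y k \<omega> = y}"
  have "(\<lambda>y. measure M (?A y)) sums measure M (\<Union>y. ?A y)"
    by (intro finite_measure_UNION) (auto simp: disjoint_family_on_def)
  moreover have "(\<Union>y. ?A y) = {\<omega> \<in> space M. Z j k \<omega> = Y k \<omega>}"
    by auto
  moreover have "measure M (?A y) = (\<theta> k * p j k) ^ y /\<^sub>R fact y * exp (- \<theta> k)" for y
    by (simp add: thinning_prob_joint[OF rep] thinning_prob_Y[OF rep] power_mult_distrib
        field_simps)
  ultimately have "(\<lambda>y. (\<theta> k * p j k) ^ y /\<^sub>R fact y * exp (- \<theta> k)) sums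
      measure M {\<omega> \<in> space M. Z j k \<omega> = Y k \<omega>}"
    by simp
  moreover have "(\<lambda>y. (\<theta> k * p j k) ^ y /\<^sub>R fact y * exp (- \<theta> k)) sums
      (exp (\<theta> k * p j k) * exp (- \<theta> k))"
    by (intro sums_mult2 exp_converges)
  ultimately have "measure M {\<omega> \<in> space M. Z j k \<omega> = Y k \<omega>} = exp (\<theta> k * p j k) * exp (- \<theta> k)"
    by (rule sums_unique2)
  then show ?thesis
    by (simp add: exp_add[symmetric] algebra_simps)
qed

text \<open>Supplies a lower bound for the denominators that does not depend on the thinning
  probabilities.\<close>

lemma thinning_prob_Y_zero:
  assumes rep: "thinning_representation M (\<theta> :: 'l::finite \<Rightarrow> real) p Y Z"
  shows "measure M {\<omega> \<in> space M. \<forall>k. Y k \<omega> = 0} = exp (- (\<Sum>k\<in>UNIV. \<theta> k))"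
proof -
  interpret prob_space M
    by (rule thinning_prob_space[OF rep])
  have "indep_vars (\<lambda>_. count_space UNIV) Y UNIV"
    using rep by (simp add: thinning_representation_def)
  then have "prob (\<Inter>k\<in>UNIV. Y k -` {0} \<inter> space M) = (\<Prod>k\<in>UNIV. prob (Y k -` {0} \<inter> space M))"
    by (rule indep_varsD) auto
  also have "\<dots> = (\<Prod>k\<in>UNIV. exp (- \<theta> k))"
  proof (rule prod.cong[OF refl])
    fix k
    have "Y k -` {0} \<inter> space M = {\<omega> \<in> space M. Y k \<omega> = 0}"
      by auto
    then show "prob (Y k -` {0} \<inter> space M) = exp (- \<theta> k)"
      using thinning_prob_Y[OF rep, of k 0] by simp
  qed
  also have "\<dots> = exp (- (\<Sum>k\<in>UNIV. \<theta> k))"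
    by (simp add: exp_sum sum_negf[symmetric])
  also have "(\<Inter>k\<in>UNIV. Y k -` {0} \<inter> space M) = {\<omega> \<in> space M. \<forall>k. Y k \<omega> = 0}"
    by auto
  finally show ?thesis .
qed

section \<open>Comparison of the distribution functions\<close>

text \<open>Treats maximum and minimum at once. Up to null sets, the events \<open>V \<le> x\<close>
  and \<open>W \<le> x\<close> differ only where some \<open>Z i k\<close> misses
  \<open>Y k\<close>. A union bound controls that event, and the factor
  \<open>exp (\<Sum>k\<in>UNIV. \<theta> k)\<close> comes from dividing by the lower bound for the
  denominator.\<close>

lemma thinning_cdf_ratio:
  assumes rep: "thinning_representation M (\<theta> :: 'l::finite \<Rightarrow> real) p Y Z"
    and V[measurable]: "V \<in> measurable M (count_space UNIV)"
    and W[measurable]: "W \<in> measurable M (count_space UNIV)"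
    and eq: "AE \<omega> in M. (\<forall>k. Z i k \<omega> = Y k \<omega>) \<longrightarrow> V \<omega> = W \<omega>"
    and zero: "AE \<omega> in M. (\<forall>k. Y k \<omega> = 0) \<longrightarrow> W \<omega> = 0"
  shows "\<bar>rv_cdf M V (real x) / rv_cdf M W (real x) - 1\<bar> \<le>
    exp (\<Sum>k\<in>UNIV. \<theta> k) * (\<Sum>k\<in>UNIV. 1 - exp (- (\<theta> k * (1 - p i k))))"
proof -
  interpret prob_space M
    by (rule thinning_prob_space[OF rep])
  note [measurable] = thinning_measurable_Y[OF rep] thinning_measurable_Z[OF rep]
  let ?V = "{\<omega> \<in> space M. V \<omega> \<le> x}" and ?W = "{\<omega> \<in> space M. W \<omega> \<le> x}"
  let ?N = "\<lambda>k. {\<omega> \<in> space M. Z i k \<omega> \<noteq> Y k \<omega>}"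
  let ?B = "\<Union>k\<in>UNIV. ?N k" and ?S = "\<Sum>k\<in>UNIV. 1 - exp (- (\<theta> k * (1 - p i k)))"
  \<comment> \<open>Equality of two random values is written as a countable union over the common
    value \<open>y\<close>, a form the measurability prover accepts.\<close>
  have [measurable]: "Measurable.pred M (\<lambda>\<omega>. Z i k \<omega> = Y k \<omega>)" for k
  proof -
    have "Measurable.pred M (\<lambda>\<omega>. \<exists>y. Z i k \<omega> = y \<and> Y k \<omega> = y)"
      by measurable
    then show ?thesis
      by (simp add: eq_commute)
  qed
  have "prob (?N k) = 1 - exp (- (\<theta> k * (1 - p i k)))" for k
    by (subst prob_neg) (auto simp: thinning_prob_full[OF rep])
  moreover have "prob ?B \<le> (\<Sum>k\<in>UNIV. prob (?N k))"
    by (intro finite_measure_subadditive_finite) auto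
  ultimately have B: "prob ?B \<le> ?S"
    by simp
  have "prob ?V \<le> prob (?W \<union> ?B)"
    using eq by (intro finite_measure_mono_AE) auto
  also have "\<dots> \<le> prob ?W + prob ?B"
    by (intro measure_Un_le) auto
  finally have 1: "prob ?V \<le> prob ?W + ?S"
    using B by simp
  have "prob ?W \<le> prob (?V \<union> ?B)"
    using eq by (intro finite_measure_mono_AE) auto
  also have "\<dots> \<le> prob ?V + prob ?B"
    by (intro measure_Un_le) auto
  finally have 2: "prob ?W \<le> prob ?V + ?S"
    using B by simp
  \<comment> \<open>Since \<open>x\<close> is a natural number, \<open>W = 0\<close> already implies
    \<open>W \<le> x\<close>.\<close>
  have "prob {\<omega> \<in> space M. \<forall>k. Y k \<omega> = 0} \<le> prob ?W"
    using zero by (intro finite_measure_mono_AE) auto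
  then have W_ge: "exp (- (\<Sum>k\<in>UNIV. \<theta> k)) \<le> prob ?W"
    by (simp add: thinning_prob_Y_zero[OF rep])
  then have pos: "0 < prob ?W"
    by (rule less_le_trans[OF exp_gt_zero])
  have "0 \<le> ?S"
    using B measure_nonneg[of M ?B] by linarith
  have "\<bar>prob ?V / prob ?W - 1\<bar> = \<bar>prob ?V - prob ?W\<bar> / prob ?W"
    using pos by (simp add: field_simps abs_if)
  also have "\<dots> \<le> ?S / exp (- (\<Sum>k\<in>UNIV. \<theta> k))"
    using 1 2 W_ge \<open>0 \<le> ?S\<close> by (intro frac_le) auto
  also have "\<dots> = exp (\<Sum>k\<in>UNIV. \<theta> k) * ?S"
    by (simp add: exp_minus field_simps)
  finally show ?thesis
    by (simp add: rv_cdf_eq)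
qed

text \<open>The bound \<open>b\<close> involves only \<open>\<theta>\<close> and row
  \<open>i\<close> of \<open>p\<close>, neither the probability space nor \<open>X\<close>, so it
  stays usable when both change with the parameters.\<close>

lemma thinning_dependence_cdf_ratios:
  fixes \<theta> :: "'l::finite \<Rightarrow> real" and p :: "'d::finite \<Rightarrow> 'l \<Rightarrow> real" and i :: 'd
    and x :: nat
  assumes "thinning_dependence_poisson M \<theta> p X"
  defines "b \<equiv> exp (\<Sum>k\<in>UNIV. \<theta> k) * (\<Sum>k\<in>UNIV. 1 - exp (- (\<theta> k * (1 - p i k))))"
  shows "\<bar>rv_cdf M (max_comp X) x / rv_cdf M (X i) x - 1\<bar> \<le> b"
    and "CARD('d) \<ge> 2 \<Longrightarrow>
      \<bar>rv_cdf M (min_comp X) x / rv_cdf M (min_comp_except i X) x - 1\<bar> \<le> b"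
proof -
  obtain Y Z where rep: "thinning_representation M \<theta> p Y Z"
    and X: "\<And>j \<omega>. \<omega> \<in> space M \<Longrightarrow> X j \<omega> = (\<Sum>k\<in>UNIV. Z j k \<omega>)"
    using assms by (auto simp: thinning_dependence_poisson_def)
  note [measurable] = thinning_measurable_Z[OF rep]
  have X_meas: "X j \<in> measurable M (count_space UNIV)" for j
  proof -
    have "(\<lambda>\<omega>. \<Sum>k\<in>UNIV. Z j k \<omega>) \<in> measurable M (count_space UNIV)"
      by measurable
    then show ?thesis
      by (subst measurable_cong[OF X]) auto
  qed
  have le: "AE \<omega> in M. \<forall>j k. Z j k \<omega> \<le> Y k \<omega>"
    by (simp add: AE_all_countable thinning_AE_le[OF rep])
  \<comment> \<open>On this event \<open>X i\<close> equals the sum of all \<open>Y k\<close>, which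
    dominates every \<open>X j\<close> term by term.\<close>
  have full: "AE \<omega> in M. (\<forall>k. Z i k \<omega> = Y k \<omega>) \<longrightarrow> (\<forall>j. X j \<omega> \<le> X i \<omega>)"
    using le AE_space by eventually_elim (auto simp: X intro!: sum_mono)
  have zero: "AE \<omega> in M. (\<forall>k. Y k \<omega> = 0) \<longrightarrow> (\<forall>j. X j \<omega> = 0)"
    using le AE_space by eventually_elim (auto simp: X)
  show "\<bar>rv_cdf M (max_comp X) x / rv_cdf M (X i) x - 1\<bar> \<le> b"
    unfolding b_def
  proof (rule thinning_cdf_ratio[OF rep measurable_max_comp[OF X_meas] X_meas])
    show "AE \<omega> in M. (\<forall>k. Z i k \<omega> = Y k \<omega>) \<longrightarrow> max_comp X \<omega> = X i \<omega>"
      using full by eventually_elim (auto intro: max_comp_eq)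
    show "AE \<omega> in M. (\<forall>k. Y k \<omega> = 0) \<longrightarrow> X i \<omega> = 0"
      using zero by eventually_elim auto
  qed
  assume "CARD('d) \<ge> 2"
  then have "\<not> UNIV \<subseteq> {i}"
    using card_mono[of "{i}" UNIV] by auto
  then obtain j where "j \<noteq> i"
    by auto
  show "\<bar>rv_cdf M (min_comp X) x / rv_cdf M (min_comp_except i X) x - 1\<bar> \<le> b"
    unfolding b_def
  proof (rule thinning_cdf_ratio[OF rep measurable_min_comp[OF X_meas]
        measurable_min_comp_except[OF X_meas]])
    show "AE \<omega> in M. (\<forall>k. Z i k \<omega> = Y k \<omega>) \<longrightarrow> min_comp X \<omega> = min_comp_except i X \<omega>"
      using full by eventually_elim (auto intro: min_comp_eq_min_comp_except[OF _ \<open>j \<noteq> i\<close>])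
    show "AE \<omega> in M. (\<forall>k. Y k \<omega> = 0) \<longrightarrow> min_comp_except i X \<omega> = 0"
      using zero by eventually_elim (auto intro: min_comp_except_eq_0[OF _ \<open>j \<noteq> i\<close>])
  qed
qed

text \<open>The vector \<open>r\<close> replaces row \<open>i\<close> of \<open>p\<close>, and each
  \<open>r\<close> may have its own probability space and random vector. The filter lets all entries
  of \<open>r\<close> tend to \<open>1\<close> jointly inside the unit cube. The minimum off
  \<open>i\<close> presupposes a second index, hence the cardinality condition.\<close>

theorem proposition4p8:
  fixes \<theta> :: "'l::finite \<Rightarrow> real"
    and p :: "'d::finite \<Rightarrow> 'l \<Rightarrow> real"
    and i :: 'd
    and M :: "real ^ 'l \<Rightarrow> 'a measure"
    and X :: "real ^ 'l \<Rightarrow> 'd \<Rightarrow> 'a \<Rightarrow> nat"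
    and x :: nat
  assumes "\<And>r. (\<And>k. 0 \<le> r $ k \<and> r $ k \<le> 1) \<Longrightarrow>
             thinning_dependence_poisson (M r) \<theta> (p(i := (\<lambda>k. r $ k))) (X r)"
  shows "((\<lambda>r. rv_cdf (M r) (max_comp (X r)) (real x) / rv_cdf (M r) (X r i) (real x)) \<longlongrightarrow> 1)
           (at (\<chi> k. 1) within {r. \<forall>k. 0 \<le> r $ k \<and> r $ k \<le> 1}) \<and>
         (CARD('d) \<ge> 2 \<longrightarrow>
         ((\<lambda>r. rv_cdf (M r) (min_comp (X r)) (real x) /
               rv_cdf (M r) (min_comp_except i (X r)) (real x)) \<longlongrightarrow> 1)
           (at (\<chi> k. 1) within {r. \<forall>k. 0 \<le> r $ k \<and> r $ k \<le> 1}))"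
proof -
  let ?F = "at ((\<chi> k. 1) :: real ^ 'l) within {r :: real ^ 'l. \<forall>k. 0 \<le> r $ k \<and> r $ k \<le> 1}"
  define b :: "real ^ 'l \<Rightarrow> real" where
    "b r = exp (\<Sum>k\<in>UNIV. \<theta> k) * (\<Sum>k\<in>UNIV. 1 - exp (- (\<theta> k * (1 - r $ k))))" for r
  \<comment> \<open>The bound is continuous in \<open>r\<close>, and each summand vanishes at
    \<open>r $ k = 1\<close>.\<close>
  have "(b \<longlongrightarrow> b (\<chi> k. 1)) ?F"
    unfolding b_def by (intro tendsto_intros)
  then have b: "(b \<longlongrightarrow> 0) ?F"
    by (simp add: b_def)
  have lim: "(f \<longlongrightarrow> 1) ?F"
    if "\<And>r. (\<And>k. 0 \<le> r $ k \<and> r $ k \<le> 1) \<Longrightarrow> \<bar>f r - 1\<bar> \<le> b r" for f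
  proof -
    have "\<forall>\<^sub>F r in ?F. norm (f r - 1) \<le> b r"
      using that by (auto simp: eventually_at_filter)
    then have "((\<lambda>r. f r - 1) \<longlongrightarrow> 0) ?F"
      using b by (rule Lim_null_comparison)
    then show ?thesis
      by (simp add: LIM_zero_iff)
  qed
  \<comment> \<open>Simplification evaluates the updated \<open>p\<close> at \<open>i\<close> to the
    entries of \<open>r\<close>, after which the bound folds to \<open>b r\<close>.\<close>
  note ratios = thinning_dependence_cdf_ratios[OF assms, where i = i, simplified, folded b_def]
  show ?thesis
    by (intro conjI impI lim ratios) auto
qed

end
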